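(* Let $\pi:P\to Q$ be a cylindrical projection of posets and let $c_Q:Q\to\mathbb R^d$ be a cubic realization of $Q$. Then the cubic realizations $c_P:P\to\mathbb R^{d+1}$ compatible with $c_Q$ and $\pi$ are in bijective correspondence with functions $h:V(R(\pi))\to\mathbb R$ on the vertex set of the pre-Reeb graph $R(\pi)$ that are strictly increasing along edges. In particular, such a compatible cubic realization exists if and only if $R(\pi)$ is acyclic.
   Context: For a poset, $x\to y$ denotes a cover relation ($x<y$ with nothing strictly between). A cubic realization of a poset $P$ is an embedding $c:P\to\mathbb R^d$ of its Hasse diagram such that for every cover $x\to y$ in $P$ the points $c(x)$ and $c(y)$ differ in exactly one coordinate, and in that coordinate one has $c(x)<c(y)$. A map $\pi:P\to Q$ of posets is a cylindrical projection if: (1) for every cover $v\to w$ in $P$, either $\pi(v)=\pi(w)$ or $\pi(v)\to\pi(w)$ is a cover in $Q$; (2) for every $q\in Q$ the fiber $\pi^{-1}(q)\subset P$ is a total order with at least 2 elements; (3) if $b(q)$ and $t(q)$ denote respectively the minimal and maximal elements of $\pi^{-1}(q)$, then the maps $b,t:Q\to P$ identify the Hasse diagram of $Q$ with induced subgraphs of the Hasse diagram of $P$; equivalently, for every cover $q\to q'$ in $Q$, the relations $b(q)\to b(q')$ and $t(q)\to t(q')$ are covers in $P$. A cubic realization $c_P:P\to\mathbb R^{d+1}$ is compatible with a cubic realization $c_Q:Q\to\mathbb R^d$ and $\pi$ if $c_P(x)=(c_Q(\pi(x)),h(x))$ for some function $h:P\to\mathbb R$. A cover $v\to w$ in $P$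 is horizontal if $\pi(v)\to\pi(w)$ is a cover in $Q$, and vertical if $\pi(v)=\pi(w)$. Let $\sim_h$ be the equivalence relation on $P$ generated by undirected adjacency along horizontal covers; $[v]$ denotes the class of $v$. The pre-Reeb graph $R(\pi)$ is the directed graph whose vertices are the $\sim_h$-equivalence classes, with an edge $[v]\to[w]$ whenever there exist representatives $v'\in[v]$, $w'\in[w]$ such that $v'\to w'$ is a vertical cover in $P$. A function $h$ on its vertices is strictly increasing along edges if $h([v])<h([w])$ for every edge $[v]\to[w]$. Acyclic means having no directed cycles (a loop counts as a directed cycle).
   Formalization: The fibers of π are assumed finite; without this the claim fails, e.g. for Q a point and P = [0,1], where P has no covers, so a constant h is admissible but gives no embedding, and for larger dense chains no realization exists although R(π) is acyclic. *)

theory Defs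
  imports "Jordan_Normal_Form.Matrix" "HOL-Library.FuncSet"
begin

definition cover :: "'a::order \<Rightarrow> 'a \<Rightarrow> bool" where
  "cover x y \<longleftrightarrow> x < y \<and> \<not> (\<exists>z. x < z \<and> z < y)"

text \<open>The space \<open>\<real>\<^sup>d\<close> is \<open>carrier_vec d\<close>, so that \<open>d\<close> is an arbitrary natural number
  (including 0) and \<open>\<real>\<^sup>d\<close> and \<open>\<real>\<^sup>d\<^sup>+\<^sup>1\<close> can be related.\<close>

definition open_edge :: "real vec \<Rightarrow> real vec \<Rightarrow> real vec set" where
  "open_edge u v = {(1 - t) \<cdot>\<^sub>v u + t \<cdot>\<^sub>v v | t. 0 < t \<and> t < 1}"

text \<open>Embedding of the Hasse diagram as a graph drawn with straight edges: distinct vertices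
  go to distinct points, and the interior of an edge meets neither a vertex nor the interior of
  another edge.\<close>

definition hasse_embedding :: "nat \<Rightarrow> ('a::order \<Rightarrow> real vec) \<Rightarrow> bool" where
  "hasse_embedding d c \<longleftrightarrow>
     range c \<subseteq> carrier_vec d \<and> inj c \<and>
     (\<forall>x y z. cover x y \<longrightarrow> c z \<notin> open_edge (c x) (c y)) \<and>
     (\<forall>x y x' y'. cover x y \<longrightarrow> cover x' y' \<longrightarrow> (x, y) \<noteq> (x', y') \<longrightarrow>
        open_edge (c x) (c y) \<inter> open_edge (c x') (c y') = {})"

definition cubic_realization :: "nat \<Rightarrow> ('a::order \<Rightarrow> real vec) \<Rightarrow> bool" where
  "cubic_realization d c \<longleftrightarrow>
     hasse_embedding d c \<and>
     (\<forall>x y. cover x y \<longrightarrow>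
        (\<exists>i<d. c x $ i < c y $ i \<and> (\<forall>j<d. j \<noteq> i \<longrightarrow> c x $ j = c y $ j)))"

definition fiber_bot :: "('p::order \<Rightarrow> 'q) \<Rightarrow> 'q \<Rightarrow> 'p" where
  "fiber_bot \<pi> q = (LEAST x. \<pi> x = q)"

definition fiber_top :: "('p::order \<Rightarrow> 'q) \<Rightarrow> 'q \<Rightarrow> 'p" where
  "fiber_top \<pi> q = (GREATEST x. \<pi> x = q)"

text \<open>A map of posets is order preserving, hence \<open>mono \<pi>\<close>; this follows from the condition on
  covers whenever the order of \<open>'p\<close> is generated by its covers, e.g. if \<open>'p\<close> is finite.
  Least and greatest elements of the fibers are required to exist, so that \<open>fiber_bot\<close> and
  \<open>fiber_top\<close> are meaningful; for finite fibers this is automatic.\<close>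

definition cylindrical_projection :: "('p::order \<Rightarrow> 'q::order) \<Rightarrow> bool" where
  "cylindrical_projection \<pi> \<longleftrightarrow>
     mono \<pi> \<and>
     (\<forall>v w. cover v w \<longrightarrow> \<pi> v = \<pi> w \<or> cover (\<pi> v) (\<pi> w)) \<and>
     (\<forall>q. (\<forall>x\<in>\<pi> -` {q}. \<forall>y\<in>\<pi> -` {q}. x \<le> y \<or> y \<le> x) \<and>
          (\<exists>x\<in>\<pi> -` {q}. \<exists>y\<in>\<pi> -` {q}. x \<noteq> y) \<and>
          (\<exists>b\<in>\<pi> -` {q}. \<forall>x\<in>\<pi> -` {q}. b \<le> x) \<and>
          (\<exists>t\<in>\<pi> -` {q}. \<forall>x\<in>\<pi> -` {q}. x \<le> t)) \<and>
     (\<forall>q q'. cover q q' \<longrightarrow>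
        cover (fiber_bot \<pi> q) (fiber_bot \<pi> q') \<and> cover (fiber_top \<pi> q) (fiber_top \<pi> q'))"

text \<open>\<open>add_coord u a\<close> is the point \<open>(u, a)\<close> of \<open>\<real>\<^sup>d\<^sup>+\<^sup>1\<close> for \<open>u\<close> in \<open>\<real>\<^sup>d\<close>.\<close>

definition add_coord :: "real vec \<Rightarrow> real \<Rightarrow> real vec" where
  "add_coord u a = u @\<^sub>v vec 1 (\<lambda>_. a)"

definition compatible ::
  "('q \<Rightarrow> real vec) \<Rightarrow> ('p \<Rightarrow> 'q) \<Rightarrow> ('p \<Rightarrow> real vec) \<Rightarrow> bool" where
  "compatible c\<^sub>Q \<pi> c\<^sub>P \<longleftrightarrow> (\<exists>h. \<forall>x. c\<^sub>P x = add_coord (c\<^sub>Q (\<pi> x)) (h x))"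

definition horizontal :: "('p::order \<Rightarrow> 'q::order) \<Rightarrow> 'p rel" where
  "horizontal \<pi> = {(v, w). cover v w \<and> cover (\<pi> v) (\<pi> w)}"

definition vertical :: "('p::order \<Rightarrow> 'q::order) \<Rightarrow> 'p rel" where
  "vertical \<pi> = {(v, w). cover v w \<and> \<pi> v = \<pi> w}"

definition hequiv :: "('p::order \<Rightarrow> 'q::order) \<Rightarrow> 'p rel" where
  "hequiv \<pi> = {(v, w). equivclp (\<lambda>x y. (x, y) \<in> horizontal \<pi>) v w}"

definition hclass :: "('p::order \<Rightarrow> 'q::order) \<Rightarrow> 'p \<Rightarrow> 'p set" where
  "hclass \<pi> v = hequiv \<pi> `` {v}"

definition reeb_verts :: "('p::order \<Rightarrow> 'q::order) \<Rightarrow> 'p set set" where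
  "reeb_verts \<pi> = UNIV // hequiv \<pi>"

definition reeb_edges :: "('p::order \<Rightarrow> 'q::order) \<Rightarrow> 'p set rel" where
  "reeb_edges \<pi> = {(C, D). C \<in> reeb_verts \<pi> \<and> D \<in> reeb_verts \<pi> \<and>
     (\<exists>v\<in>C. \<exists>w\<in>D. (v, w) \<in> vertical \<pi>)}"

text \<open>Functions on the vertex set only: extensional outside \<open>reeb_verts \<pi>\<close>.\<close>

definition reeb_heights :: "('p::order \<Rightarrow> 'q::order) \<Rightarrow> ('p set \<Rightarrow> real) set" where
  "reeb_heights \<pi> = {h \<in> reeb_verts \<pi> \<rightarrow>\<^sub>E UNIV. \<forall>(C, D)\<in>reeb_edges \<pi>. h C < h D}"

end

theory Submission
  imports Defs "HOL-Library.Countable_Set"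
begin

text \<open>A compatible realization over \<open>c\<^sub>Q\<close> is determined by its last coordinate \<open>g\<close>. A cover moves
  exactly one coordinate, so \<open>g\<close> must stay put along a horizontal cover, where a coordinate of
  \<open>c\<^sub>Q\<close> already moves, and must grow along a vertical one, where all coordinates of \<open>c\<^sub>Q\<close> are
  fixed. Being constant along horizontal covers means factoring through the vertices of the
  pre-Reeb graph, and then growth along vertical covers means strict increase along its edges.
  So the functions \<open>g\<close> with these two properties (\<open>height_function\<close>) correspond to the functions on
  the pre-Reeb graph (\<open>reeb_heights_bij_height_functions\<close>).

  Conversely, every such \<open>g\<close> gives an embedding (\<open>height_function_hasse_embedding\<close>). Since the
  fibers are finite chains whose consecutive elements are joined by vertical covers, \<open>g\<close> is
  strictly increasing on each fiber; thus points over the same point of the base are separated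
  by their height. A vertical edge projects to a vertex of the drawing of the base and a
  horizontal edge to an edge, so that any unwanted intersection either projects to one in the
  base or happens between edges over the same vertex or over the same edge, where heights
  separate them.

  A strictly increasing function forbids directed cycles. The converse is a statement about
  possibly infinite graphs, and an acyclic graph may be too large to carry a strictly
  increasing function into the reals. Here the realization of the base bounds the size: from a
  vertex of \<open>Q\<close> at most one edge leaves in each of the \<open>2d\<close> coordinate directions, since two
  such edges would overlap. Hence the Hasse diagrams of \<open>Q\<close> and \<open>P\<close> are locally finite and the
  pre-Reeb graph is locally countable, which suffices to construct a function
  (\<open>acyclic_locally_countable_strictly_increasing\<close>).\<close>

section \<open>Heights for acyclic relations\<close>

lemma countable_undirected_component:
  assumes "\<And>x. countable ((r \<union> r\<inverse>) `` {x})"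
  shows "countable ((r \<union> r\<inverse>)\<^sup>* `` {x})"
proof (rule countable_rtrancl)
  fix Y :: "'a set" assume "countable Y"
  moreover have "(r \<union> r\<inverse>) `` Y = (\<Union>y\<in>Y. (r \<union> r\<inverse>) `` {y})" by auto
  ultimately show "countable ((r \<union> r\<inverse>) `` Y)" using assms by simp
qed simp

lemma suminf_half_powers_strict_mono:
  assumes "A \<subset> B"
  shows "(\<Sum>n. if n \<in> A then (1/2::real) ^ n else 0) < (\<Sum>n. if n \<in> B then (1/2) ^ n else 0)"
proof -
  define f where "f S n = (if n \<in> S then (1/2::real) ^ n else 0)" for S :: "nat set" and n
  have summable: "summable (f S)" for S
    by (rule summable_comparison_test'[where g = "\<lambda>n. (1/2) ^ n" and N = 0])
       (auto simp: f_def summable_geometric)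
  obtain b where b: "b \<in> B" "b \<notin> A" using assms by auto
  have "0 < (\<Sum>n. f B n - f A n)"
  proof (rule suminf_pos2)
    show "summable (\<lambda>n. f B n - f A n)" by (intro summable_diff summable)
    show "0 \<le> f B n - f A n" for n using assms by (auto simp: f_def)
    show "0 < f B b - f A b" using b by (simp add: f_def)
  qed
  also have "\<dots> = suminf (f B) - suminf (f A)" by (rule suminf_diff[symmetric]; rule summable)
  finally have "suminf (f A) < suminf (f B)" by simp
  then show ?thesis unfolding f_def .
qed

lemma acyclic_if_strictly_increasing:
  fixes h :: "'a \<Rightarrow> 'b::order"
  assumes "\<And>x y. (x, y) \<in> r \<Longrightarrow> h x < h y"
  shows "acyclic r"
proof -
  have "h x < h y" if "(x, y) \<in> r\<^sup>+" for x y
    using that by induction (auto dest: assms intro: less_trans)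
  then show ?thesis unfolding acyclic_def by blast
qed

text \<open>Local countability makes every weakly connected component countable, so its vertices \<open>w\<close> can be
  given weights \<open>2\<^sup>-\<^sup>n\<close> with distinct exponents \<open>n\<close>. The height of \<open>x\<close> is the total weight of the
  vertices from which \<open>x\<close> can be reached. Along an edge from \<open>x\<close> to \<open>y\<close> this set of vertices
  grows, and by acyclicity it gains at least \<open>y\<close>.\<close>

lemma acyclic_locally_countable_strictly_increasing:
  fixes r :: "'a rel"
  assumes "acyclic r" and "\<And>x. countable ((r \<union> r\<inverse>) `` {x})"
  obtains h :: "'a \<Rightarrow> real" where "\<And>x y. (x, y) \<in> r \<Longrightarrow> h x < h y"
proof -
  define K where "K x = (r \<union> r\<inverse>)\<^sup>* `` {x}" for x
  have K_countable: "countable (K x)" for x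
    unfolding K_def by (rule countable_undirected_component) (rule assms(2))
  have "sym ((r \<union> r\<inverse>)\<^sup>*)" by (simp add: sym_rtrancl sym_Un_converse)
  then have K_eq: "K x = K y" if "x \<in> K y" for x y
    using that unfolding K_def by (auto dest: symD intro: rtrancl_trans)
  (* Encoding w relative to its own component makes code a single function on all vertices, so
     that the heights of the two ends of an edge use the same weights. *)
  define code where "code x = to_nat_on (K x) x" for x
  have code_inj: "inj_on code (K y)" for y
  proof (rule inj_onI)
    fix a b assume "a \<in> K y" "b \<in> K y" "code a = code b"
    then show "a = b"
      using K_eq[of a y] K_eq[of b y] inj_on_to_nat_on[OF K_countable[of y]]
      by (auto simp: code_def dest: inj_onD)
  qed
  define D where "D x = {w. (w, x) \<in> r\<^sup>*}" for x
  define h where "h x = (\<Sum>n. if n \<in> code ` D x then (1/2::real) ^ n else 0)" for x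
  have D_subset: "D x \<subseteq> K x" for x
  proof
    fix w assume "w \<in> D x"
    then have "(w, x) \<in> (r \<union> r\<inverse>)\<^sup>*"
      unfolding D_def using rtrancl_mono[of r "r \<union> r\<inverse>"] by blast
    then show "w \<in> K x" using \<open>sym ((r \<union> r\<inverse>)\<^sup>*)\<close> by (auto simp: K_def dest: symD)
  qed
  have "h x < h y" if "(x, y) \<in> r" for x y
  proof -
    have sub: "D x \<subseteq> D y" using that by (auto simp: D_def)
    have "y \<notin> D x"
      using that assms(1) unfolding D_def acyclic_def by (auto dest: rtrancl_into_trancl1)
    moreover have "y \<in> D y" by (simp add: D_def)
    ultimately have "D x \<subset> D y" using sub by auto
    then have "code ` D x \<subset> code ` D y"
      by (rule image_strict_mono[OF inj_on_subset[OF code_inj D_subset]])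
    then show ?thesis unfolding h_def by (rule suminf_half_powers_strict_mono)
  qed
  then show thesis by (rule that)
qed

section \<open>Edges drawn in coordinate space\<close>

lemma open_edge_sym: "u \<in> carrier_vec n \<Longrightarrow> v \<in> carrier_vec n \<Longrightarrow> open_edge u v = open_edge v u"
proof -
  have sub: "open_edge u v \<subseteq> open_edge v u"
    if "u \<in> carrier_vec n" "v \<in> carrier_vec n" for u v
  proof
    fix p assume "p \<in> open_edge u v"
    then obtain t where t: "p = (1 - t) \<cdot>\<^sub>v u + t \<cdot>\<^sub>v v" "0 < t" "t < 1"
      by (auto simp: open_edge_def)
    then have "p = (1 - (1 - t)) \<cdot>\<^sub>v v + (1 - t) \<cdot>\<^sub>v u" using that by auto
    then show "p \<in> open_edge v u" using t(2,3) unfolding open_edge_def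
      by (intro CollectI exI[of _ "1 - t"]) simp
  qed
  show "u \<in> carrier_vec n \<Longrightarrow> v \<in> carrier_vec n \<Longrightarrow> open_edge u v = open_edge v u"
    using sub[of u v] sub[of v u] by blast
qed

text \<open>Two edges that leave the same point along the same axis and in the same sense run along a
  common ray, so the shorter lies on the longer.\<close>

lemma parallel_open_edges_meet:
  assumes "u \<in> carrier_vec d" "v \<in> carrier_vec d" "w \<in> carrier_vec d"
    and "0 < (v $ i - u $ i) * (w $ i - u $ i)"
    and "\<And>j. j < d \<Longrightarrow> j \<noteq> i \<Longrightarrow> u $ j = v $ j \<and> u $ j = w $ j"
  shows "open_edge u v \<inter> open_edge u w \<noteq> {}"
proof -
  define a b where "a = v $ i - u $ i" and "b = w $ i - u $ i"
  (* Both points have i-th coordinate u $ i + a * b / (a + b), half the harmonic mean of the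
     two displacements. *)
  define s t where "s = b / (a + b)" and "t = a / (a + b)"
  have ab: "0 < a * b" using assms(4) by (simp add: a_def b_def)
  then have st: "0 < s" "s < 1" "0 < t" "t < 1"
    by (auto simp: s_def t_def zero_less_mult_iff field_simps)
  have meet: "s * a = t * b" by (simp add: s_def t_def)
  have "(1 - s) \<cdot>\<^sub>v u + s \<cdot>\<^sub>v v = (1 - t) \<cdot>\<^sub>v u + t \<cdot>\<^sub>v w"
  proof (rule eq_vecI)
    fix j assume "j < dim_vec ((1 - t) \<cdot>\<^sub>v u + t \<cdot>\<^sub>v w)"
    then have j: "j < d" using assms by simp
    show "((1 - s) \<cdot>\<^sub>v u + s \<cdot>\<^sub>v v) $ j = ((1 - t) \<cdot>\<^sub>v u + t \<cdot>\<^sub>v w) $ j"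
    proof (cases "j = i")
      case True
      then show ?thesis using meet j assms(1-3) by (simp add: a_def b_def algebra_simps)
    next
      case False
      then show ?thesis using assms(5)[OF j False] j assms(1-3) by (auto simp: algebra_simps)
    qed
  qed (use assms in auto)
  then show ?thesis using st unfolding open_edge_def by blast
qed

text \<open>A neighbour is determined by the axis and the sense of the edge that leads to it, because edges
  with the same direction would overlap.\<close>

lemma cubic_realization_locally_finite:
  fixes c :: "'a::order \<Rightarrow> real vec" and x :: 'a
  assumes "cubic_realization d c"
  shows "finite {y. cover x y \<or> cover y x}"
proof -
  let ?N = "{y. cover x y \<or> cover y x}"
  have emb: "hasse_embedding d c" using assms by (simp add: cubic_realization_def)
  have carr: "c y \<in> carrier_vec d" for y using emb by (auto simp: hasse_embedding_def)
  have sym: "open_edge (c y) (c x) = open_edge (c x) (c y)" for y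
    by (rule open_edge_sym[OF carr carr])
  have disjoint: "open_edge (c x) (c y) \<inter> open_edge (c x) (c z) = {}"
    if "y \<in> ?N" "z \<in> ?N" "y \<noteq> z" for y z
  proof -
    have "open_edge (c a) (c b) \<inter> open_edge (c a') (c b') = {}"
      if "cover a b" "cover a' b'" "(a, b) \<noteq> (a', b')" for a b a' b'
      using emb that unfolding hasse_embedding_def by blast
    from this[of x y x z] this[of x y z x] this[of y x x z] this[of y x z x]
    show ?thesis using that unfolding sym[of y] sym[of z] by (auto simp: cover_def)
  qed
  define axis where "axis y i \<longleftrightarrow> i < d \<and> c x $ i \<noteq> c y $ i \<and>
    (\<forall>j<d. j \<noteq> i \<longrightarrow> c x $ j = c y $ j)" for y i
  have "\<exists>i. axis y i" if "y \<in> ?N" for y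
  proof -
    have step: "\<exists>i<d. c a $ i < c b $ i \<and> (\<forall>j<d. j \<noteq> i \<longrightarrow> c a $ j = c b $ j)"
      if "cover a b" for a b
      using assms that unfolding cubic_realization_def by blast
    from that consider "cover x y" | "cover y x" by blast
    then show ?thesis
    proof cases
      case 1
      then show ?thesis using step[of x y] unfolding axis_def by (metis less_irrefl)
    next
      case 2
      then show ?thesis using step[of y x] unfolding axis_def by (metis less_irrefl)
    qed
  qed
  then obtain i where i: "\<And>y. y \<in> ?N \<Longrightarrow> axis y (i y)" by metis
  define direction where "direction y = (i y, c x $ i y < c y $ i y)" for y
  have "inj_on direction ?N"
  proof (rule inj_onI, rule ccontr)
    fix y z assume yz: "y \<in> ?N" "z \<in> ?N" "direction y = direction z" "y \<noteq> z"
    then have "axis y (i y)" "axis z (i y)" "c x $ i y < c y $ i y \<longleftrightarrow> c x $ i y < c z $ i y"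
      using i[of y] i[of z] by (auto simp: direction_def)
    then have "open_edge (c x) (c y) \<inter> open_edge (c x) (c z) \<noteq> {}"
      by (intro parallel_open_edges_meet[OF carr carr carr, where i = "i y"])
         (auto simp: axis_def zero_less_mult_iff)
    then show False using disjoint yz by blast
  qed
  moreover have "direction ` ?N \<subseteq> {..<d} \<times> UNIV" using i by (auto simp: direction_def axis_def)
  then have "finite (direction ` ?N)" by (rule finite_subset) simp
  ultimately show ?thesis by (meson finite_imageD)
qed

lemma add_coord_index_less:
  "u \<in> carrier_vec d \<Longrightarrow> i < d \<Longrightarrow> add_coord u a $ i = u $ i"
  by (auto simp: add_coord_def)

lemma add_coord_index_last: "u \<in> carrier_vec d \<Longrightarrow> add_coord u a $ d = a"
  by (auto simp: add_coord_def)

lemma add_coord_carrier: "u \<in> carrier_vec d \<Longrightarrow> add_coord u a \<in> carrier_vec (d + 1)"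
  by (rule carrier_vecI) (simp add: add_coord_def)

lemma add_coord_eq_iff:
  assumes "u \<in> carrier_vec d" "v \<in> carrier_vec d"
  shows "add_coord u a = add_coord v b \<longleftrightarrow> u = v \<and> a = b"
proof
  assume "add_coord u a = add_coord v b"
  then show "u = v \<and> a = b"
    using assms by (metis append_vec_eq add_coord_def add_coord_index_last)
qed simp

lemma add_coord_in_open_edge_iff:
  assumes "u \<in> carrier_vec d" "v \<in> carrier_vec d"
  shows "p \<in> open_edge (add_coord u a) (add_coord v b) \<longleftrightarrow>
    (\<exists>t. 0 < t \<and> t < 1 \<and>
      p = add_coord ((1 - t) \<cdot>\<^sub>v u + t \<cdot>\<^sub>v v) ((1 - t) * a + t * b))"
proof -
  have "(1 - t) \<cdot>\<^sub>v add_coord u a + t \<cdot>\<^sub>v add_coord v b =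
      add_coord ((1 - t) \<cdot>\<^sub>v u + t \<cdot>\<^sub>v v) ((1 - t) * a + t * b)" for t
    by (rule eq_vecI) (use assms in \<open>auto simp: add_coord_def\<close>)
  then show ?thesis by (auto simp: open_edge_def)
qed

text \<open>The interior of an edge that moves only the last coordinate is an open interval over a point.\<close>

lemma add_coord_vertical_edge:
  assumes "u \<in> carrier_vec d" "a < b" "p \<in> open_edge (add_coord u a) (add_coord u b)"
  obtains s where "p = add_coord u s" "a < s" "s < b"
proof -
  obtain t where t: "0 < t" "t < 1"
    "p = add_coord ((1 - t) \<cdot>\<^sub>v u + t \<cdot>\<^sub>v u) ((1 - t) * a + t * b)"
    using assms by (auto simp: add_coord_in_open_edge_iff)
  have "(1 - t) \<cdot>\<^sub>v u + t \<cdot>\<^sub>v u = u"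
    by (rule eq_vecI) (auto simp: algebra_simps)
  moreover have "a < (1 - t) * a + t * b"
    using mult_strict_left_mono[OF assms(2) t(1)] by (simp add: algebra_simps)
  moreover have "(1 - t) * a + t * b < b"
    using mult_strict_left_mono[OF assms(2), of "1 - t"] t(2) by (simp add: algebra_simps)
  ultimately show thesis using t(3) that by metis
qed

text \<open>The interior of an edge on which the last coordinate is constant is a copy, at that height, of
  the interior of its projection.\<close>

lemma add_coord_horizontal_edge:
  assumes "u \<in> carrier_vec d" "v \<in> carrier_vec d"
    and "p \<in> open_edge (add_coord u a) (add_coord v a)"
  obtains q where "p = add_coord q a" "q \<in> open_edge u v" "q \<in> carrier_vec d"
proof -
  obtain t where t: "0 < t" "t < 1"
    "p = add_coord ((1 - t) \<cdot>\<^sub>v u + t \<cdot>\<^sub>v v) ((1 - t) * a + t * a)"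
    using assms by (auto simp: add_coord_in_open_edge_iff)
  moreover have "(1 - t) * a + t * a = a" by (simp add: algebra_simps)
  ultimately show thesis
    using that[of "(1 - t) \<cdot>\<^sub>v u + t \<cdot>\<^sub>v v"] assms(1,2) by (auto simp: open_edge_def)
qed

section \<open>Functions on the pre-Reeb graph\<close>

text \<open>The pullbacks to the poset of the strictly increasing functions on the pre-Reeb graph.\<close>

definition height_function :: "('p::order \<Rightarrow> 'q::order) \<Rightarrow> ('p \<Rightarrow> real) \<Rightarrow> bool" where
  "height_function \<pi> g \<longleftrightarrow>
     (\<forall>(v, w)\<in>horizontal \<pi>. g v = g w) \<and> (\<forall>(v, w)\<in>vertical \<pi>. g v < g w)"

lemma equiv_hequiv: "equiv UNIV (hequiv \<pi>)"
  unfolding hequiv_def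
  by (rule equivI)
     (auto simp: refl_on_def sym_def trans_def dest: equivclp_sym intro: equivclp_trans)

lemma hclass_self: "v \<in> hclass \<pi> v"
  by (simp add: hclass_def hequiv_def)

lemma hclass_in_reeb_verts: "hclass \<pi> v \<in> reeb_verts \<pi>"
  by (simp add: hclass_def reeb_verts_def quotientI)

lemma reeb_vert_eq_hclass:
  assumes "C \<in> reeb_verts \<pi>" "v \<in> C"
  shows "C = hclass \<pi> v"
  using assms equiv_class_eq[OF equiv_hequiv] unfolding reeb_verts_def hclass_def quotient_def
  by blast

lemma reeb_edges_eq: "reeb_edges \<pi> = {(hclass \<pi> v, hclass \<pi> w) | v w. (v, w) \<in> vertical \<pi>}"
proof (intro equalityI subsetI)
  fix e assume "e \<in> reeb_edges \<pi>"
  then obtain C D v w where e: "e = (C, D)" "C \<in> reeb_verts \<pi>" "v \<in> C" "D \<in> reeb_verts \<pi>" "w \<in> D"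
      "(v, w) \<in> vertical \<pi>"
    unfolding reeb_edges_def by blast
  then have "e = (hclass \<pi> v, hclass \<pi> w)"
    using reeb_vert_eq_hclass[OF e(2,3)] reeb_vert_eq_hclass[OF e(4,5)] by simp
  then show "e \<in> {(hclass \<pi> v, hclass \<pi> w) | v w. (v, w) \<in> vertical \<pi>}" using e(6) by blast
next
  fix e assume "e \<in> {(hclass \<pi> v, hclass \<pi> w) | v w. (v, w) \<in> vertical \<pi>}"
  then show "e \<in> reeb_edges \<pi>"
    unfolding reeb_edges_def using hclass_self hclass_in_reeb_verts by blast
qed

lemma horizontal_hclass_eq: "(v, w) \<in> horizontal \<pi> \<Longrightarrow> hclass \<pi> v = hclass \<pi> w"
  unfolding hclass_def
  by (rule equiv_class_eq[OF equiv_hequiv]) (auto simp: hequiv_def)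

lemma horizontally_constant_on_hclass:
  assumes "\<And>v w. (v, w) \<in> horizontal \<pi> \<Longrightarrow> g v = g w" and "w \<in> hclass \<pi> v"
  shows "g w = g v"
proof -
  have "equivclp (\<lambda>x y. (x, y) \<in> horizontal \<pi>) v w"
    using assms(2) by (simp add: hclass_def hequiv_def)
  then show ?thesis by induction (use assms(1) in auto)
qed

text \<open>Extensionality outside the vertex set is what makes the pullback injective: every vertex is the
  class of some element, so the pullback determines all remaining values.\<close>

lemma reeb_heights_bij_height_functions:
  "bij_betw (\<lambda>h x. h (hclass \<pi> x)) (reeb_heights \<pi>) {g. height_function \<pi> g}"
proof (rule bij_betw_imageI)
  show "inj_on (\<lambda>h x. h (hclass \<pi> x)) (reeb_heights \<pi>)"
  proof (rule inj_onI)
    fix h k assume "h \<in> reeb_heights \<pi>" "k \<in> reeb_heights \<pi>"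
      and eq: "(\<lambda>x. h (hclass \<pi> x)) = (\<lambda>x. k (hclass \<pi> x))"
    then have "h \<in> extensional (reeb_verts \<pi>)" "k \<in> extensional (reeb_verts \<pi>)"
      by (auto simp: reeb_heights_def PiE_def)
    moreover have "h C = k C" if "C \<in> reeb_verts \<pi>" for C
      using that fun_cong[OF eq] by (auto simp: reeb_verts_def hclass_def elim!: quotientE)
    ultimately show "h = k" by (rule extensionalityI)
  qed
  show "(\<lambda>h x. h (hclass \<pi> x)) ` reeb_heights \<pi> = {g. height_function \<pi> g}"
  proof (intro equalityI subsetI)
    fix g assume "g \<in> (\<lambda>h x. h (hclass \<pi> x)) ` reeb_heights \<pi>"
    then show "g \<in> {g. height_function \<pi> g}"
      by (fastforce simp: height_function_def reeb_heights_def reeb_edges_eq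
          dest: horizontal_hclass_eq)
  next
    fix g assume "g \<in> {g. height_function \<pi> g}"
    then have hor: "\<And>v w. (v, w) \<in> horizontal \<pi> \<Longrightarrow> g v = g w"
      and ver: "\<And>v w. (v, w) \<in> vertical \<pi> \<Longrightarrow> g v < g w"
      by (auto simp: height_function_def)
    define h where "h = restrict (\<lambda>C. g (SOME v. v \<in> C)) (reeb_verts \<pi>)"
    have h: "h (hclass \<pi> x) = g x" for x
      using horizontally_constant_on_hclass[of \<pi> g, OF hor]
        someI[of "\<lambda>v. v \<in> hclass \<pi> x", OF hclass_self]
      by (simp add: h_def hclass_in_reeb_verts)
    have "h \<in> reeb_heights \<pi>"
      using ver by (auto simp: reeb_heights_def reeb_edges_eq h) (simp add: h_def)
    then show "g \<in> (\<lambda>h x. h (hclass \<pi> x)) ` reeb_heights \<pi>"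
      by (rule rev_image_eqI) (simp add: h)
  qed
qed

section \<open>Realizations over a realized base\<close>

text \<open>By monotonicity everything between two elements of a fiber lies in that fiber, so an interval
  with ends in a fiber is finite and can be refined until only covers are left.\<close>

lemma fiber_less_imp_vertical_trancl:
  assumes "mono \<pi>" "finite (\<pi> -` {\<pi> x})" "x < y" "\<pi> x = \<pi> y"
  shows "(x, y) \<in> (vertical \<pi>)\<^sup>+"
  using assms(2-)
proof (induction "card {x<..<y}" arbitrary: x y rule: less_induct)
  case less
  show ?case
  proof (cases "cover x y")
    case True
    then show ?thesis using less.prems by (auto simp: vertical_def)
  next
    case False
    then obtain z where z: "x < z" "z < y" using less.prems by (auto simp: cover_def)
    have same: "\<pi> w = \<pi> x" if "x < w" "w < y" for w
      using that less.prems assms(1) by (metis antisym less_imp_le monoD)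
    then have "{x<..<y} \<subseteq> \<pi> -` {\<pi> x}" by auto
    then have fin: "finite {x<..<y}" using less.prems(1) by (rule finite_subset)
    have "{x<..<z} \<subset> {x<..<y}" "{z<..<y} \<subset> {x<..<y}" using z by auto
    then have "card {x<..<z} < card {x<..<y}" "card {z<..<y} < card {x<..<y}"
      using fin by (auto intro: psubset_card_mono)
    then have "(x, z) \<in> (vertical \<pi>)\<^sup>+" "(z, y) \<in> (vertical \<pi>)\<^sup>+"
      using less.hyps less.prems z same[OF z] by auto
    then show ?thesis by (rule trancl_trans)
  qed
qed

lemma height_function_fiber_strict_mono:
  assumes "height_function \<pi> g" "mono \<pi>" "finite (\<pi> -` {\<pi> x})" "\<pi> x = \<pi> y" "x < y"
  shows "g x < g y"
proof -
  have "(x, y) \<in> (vertical \<pi>)\<^sup>+" using assms by (intro fiber_less_imp_vertical_trancl)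
  then show ?thesis
    by induction (use assms(1) in \<open>auto simp: height_function_def intro: less_trans\<close>)
qed

lemma height_function_fiber_less_iff:
  assumes "height_function \<pi> g" "cylindrical_projection \<pi>" "finite (\<pi> -` {\<pi> x})" "\<pi> x = \<pi> y"
  shows "g x < g y \<longleftrightarrow> x < y"
proof -
  have "mono \<pi>" using assms(2) by (simp add: cylindrical_projection_def)
  moreover have "\<forall>q. \<forall>x\<in>\<pi> -` {q}. \<forall>y\<in>\<pi> -` {q}. x \<le> y \<or> y \<le> x"
    using assms(2) unfolding cylindrical_projection_def by blast
  then have "x \<le> y \<or> y \<le> x" using assms(4) by (metis vimage_singleton_eq)
  ultimately show ?thesis
    using height_function_fiber_strict_mono[of \<pi> g x y]
      height_function_fiber_strict_mono[of \<pi> g y x] assms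
    by (metis order_less_asym order_le_imp_less_or_eq)
qed

lemma cover_cases:
  assumes "cylindrical_projection \<pi>" "cover x y"
  obtains (vertical) "(x, y) \<in> vertical \<pi>" | (horizontal) "(x, y) \<in> horizontal \<pi>"
  using assms unfolding cylindrical_projection_def vertical_def horizontal_def by blast

text \<open>The single coordinate that moves along a cover is one of the base for a horizontal cover and the
  last one for a vertical cover.\<close>

lemma cubic_realization_add_coord_imp_height_function:
  assumes base: "cubic_realization d c"
    and cP: "cubic_realization (d + 1) (\<lambda>x. add_coord (c (\<pi> x)) (g x))"
  shows "height_function \<pi> g"
proof -
  have carr: "c q \<in> carrier_vec d" for q
    using base by (auto simp: cubic_realization_def hasse_embedding_def)
  have step: "\<exists>i<d + 1. add_coord (c (\<pi> v)) (g v) $ i < add_coord (c (\<pi> w)) (g w) $ i \<and>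
      (\<forall>j<d + 1. j \<noteq> i \<longrightarrow> add_coord (c (\<pi> v)) (g v) $ j = add_coord (c (\<pi> w)) (g w) $ j)"
    if "cover v w" for v w
    using cP that unfolding cubic_realization_def by blast
  have "g v = g w" if "(v, w) \<in> horizontal \<pi>" for v w
  proof -
    have cov: "cover v w" "cover (\<pi> v) (\<pi> w)" using that by (auto simp: horizontal_def)
    obtain k where k: "k < d" "c (\<pi> v) $ k < c (\<pi> w) $ k"
      using base cov(2) unfolding cubic_realization_def by blast
    obtain i where i: "\<forall>j<d + 1. j \<noteq> i \<longrightarrow>
        add_coord (c (\<pi> v)) (g v) $ j = add_coord (c (\<pi> w)) (g w) $ j"
      using step[OF cov(1)] by blast
    have "i = k"
    proof (rule ccontr)
      assume "i \<noteq> k"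
      then have "add_coord (c (\<pi> v)) (g v) $ k = add_coord (c (\<pi> w)) (g w) $ k"
        using i k(1) by auto
      then show False using k by (simp add: add_coord_index_less[OF carr])
    qed
    then have "add_coord (c (\<pi> v)) (g v) $ d = add_coord (c (\<pi> w)) (g w) $ d"
      using i k(1) by auto
    then show ?thesis by (simp add: add_coord_index_last[OF carr])
  qed
  moreover have "g v < g w" if "(v, w) \<in> vertical \<pi>" for v w
  proof -
    have cov: "cover v w" "\<pi> v = \<pi> w" using that by (auto simp: vertical_def)
    obtain i where i: "i < d + 1"
        "add_coord (c (\<pi> v)) (g v) $ i < add_coord (c (\<pi> w)) (g w) $ i"
      using step[OF cov(1)] by blast
    have "\<not> i < d" using i(2) cov(2) by (auto simp: add_coord_index_less[OF carr])
    then have "i = d" using i(1) by simp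
    then show ?thesis using i(2) by (simp add: add_coord_index_last[OF carr])
  qed
  ultimately show ?thesis by (auto simp: height_function_def)
qed

text \<open>Coincidences that survive in the projection to the base lie over a single vertex or a single
  edge. Over a vertex, the order of the fiber is the order of the heights, and distinct covers in
  a chain span disjoint open intervals. Over an edge, all drawn edges are parallel copies at
  constant heights, and the height determines the lower end.\<close>

lemma height_function_hasse_embedding:
  assumes cyl: "cylindrical_projection \<pi>" and fin: "\<And>q. finite (\<pi> -` {q})"
    and base: "hasse_embedding d c" and g: "height_function \<pi> g"
  shows "hasse_embedding (d + 1) (\<lambda>x. add_coord (c (\<pi> x)) (g x))"
proof -
  let ?e = "\<lambda>x. add_coord (c (\<pi> x)) (g x)"
  have carr: "c q \<in> carrier_vec d" for q using base by (auto simp: hasse_embedding_def)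
  have c_inj: "c q = c q' \<longleftrightarrow> q = q'" for q q'
    using base by (auto simp: hasse_embedding_def dest: injD)
  have c_vertex: "c q'' \<notin> open_edge (c q) (c q')" if "cover q q'" for q q' q''
    using base that by (auto simp: hasse_embedding_def)
  have c_edge: "(q, q') = (k, k')"
    if "cover q q'" "cover k k'" "p \<in> open_edge (c q) (c q')" "p \<in> open_edge (c k) (c k')"
    for q q' k k' p
    using base that unfolding hasse_embedding_def by blast
  have less_iff: "g x < g y \<longleftrightarrow> x < y" if "\<pi> x = \<pi> y" for x y
    using height_function_fiber_less_iff[OF g cyl fin that] .
  have total: "x < y \<or> x = y \<or> y < x" if "\<pi> x = \<pi> y" for x y
    using cyl that unfolding cylindrical_projection_def
    by (metis order_le_less vimage_singleton_eq)
  have eq_iff: "g x = g y \<longleftrightarrow> x = y" if "\<pi> x = \<pi> y" for x y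
    using total[OF that] less_iff[OF that] less_iff[OF that[symmetric]] by auto
  have hor: "cover (\<pi> x) (\<pi> y)" "g x = g y" if "(x, y) \<in> horizontal \<pi>" for x y
    using g that by (auto simp: height_function_def horizontal_def)
  have ver: "cover x y" "\<pi> x = \<pi> y" "g x < g y" if "(x, y) \<in> vertical \<pi>" for x y
    using g that by (auto simp: height_function_def vertical_def)
  have on_vertical: "\<exists>s. p = add_coord (c (\<pi> x)) s \<and> g x < s \<and> s < g y"
    if "(x, y) \<in> vertical \<pi>" "p \<in> open_edge (?e x) (?e y)" for x y p
    using add_coord_vertical_edge[OF carr ver(3)[OF that(1)], of p "\<pi> x"] that(2)
      ver(2)[OF that(1)] by metis
  have on_horizontal: "\<exists>q\<in>open_edge (c (\<pi> x)) (c (\<pi> y)).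
      q \<in> carrier_vec d \<and> p = add_coord q (g x)"
    if "(x, y) \<in> horizontal \<pi>" "p \<in> open_edge (?e x) (?e y)" for x y p
    using add_coord_horizontal_edge[OF carr carr, of p "\<pi> x" "g x" "\<pi> y"] that(2)
      hor(2)[OF that(1)] by metis
  have "range ?e \<subseteq> carrier_vec (d + 1)" using add_coord_carrier[OF carr] by auto
  moreover have "inj ?e"
    by (rule injI) (auto simp: add_coord_eq_iff[OF carr carr] c_inj eq_iff)
  moreover have "?e z \<notin> open_edge (?e x) (?e y)" if "cover x y" for x y z
  proof
    assume z: "?e z \<in> open_edge (?e x) (?e y)"
    from cyl that show False
    proof (cases rule: cover_cases)
      case vertical
      from on_vertical[OF this z] have "\<pi> z = \<pi> x" "g x < g z" "g z < g y"
        by (auto simp: add_coord_eq_iff[OF carr carr] c_inj)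
      then have "x < z" "z < y" using less_iff ver(2)[OF vertical] by auto
      then show False using that by (auto simp: cover_def)
    next
      case horizontal
      from on_horizontal[OF this z] c_vertex[OF hor(1)[OF horizontal]] show False
        by (auto simp: add_coord_eq_iff[where d = d] carr)
    qed
  qed
  moreover have "(x, y) = (x', y')"
    if cov: "cover x y" "cover x' y'" and p: "p \<in> open_edge (?e x) (?e y)"
      "p \<in> open_edge (?e x') (?e y')" for x y x' y' p
  proof -
    (* A vertical edge lies over a vertex of the base and a horizontal one over an edge. *)
    have mixed: False
      if "(v, w) \<in> vertical \<pi>" "(v', w') \<in> horizontal \<pi>" "p \<in> open_edge (?e v) (?e w)"
        "p \<in> open_edge (?e v') (?e w')" for v w v' w'
      using on_vertical[OF that(1,3)] on_horizontal[OF that(2,4)] c_vertex[OF hor(1)[OF that(2)]]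
      by (auto simp: add_coord_eq_iff[where d = d] carr)
    from cyl cov(1) show ?thesis
    proof (cases rule: cover_cases)
      case v: vertical
      from cyl cov(2) show ?thesis
      proof (cases rule: cover_cases)
        case v': vertical
        obtain s where s: "\<pi> x = \<pi> x'" "g x < s" "s < g y" "g x' < s" "s < g y'"
          using on_vertical[OF v p(1)] on_vertical[OF v' p(2)]
          by (auto simp: add_coord_eq_iff[OF carr carr] c_inj)
        have "x < y'" "x' < y"
          using less_iff[of x y'] less_iff[of x' y] s ver(2)[OF v] ver(2)[OF v'] by auto
        (* Two covers in a chain whose spans overlap coincide. *)
        moreover from this have "x = x'"
          using total[OF s(1)] cov by (auto simp: cover_def)
        moreover have "y = y'"
          using total[of y y'] s(1) ver(2)[OF v] ver(2)[OF v'] cov calculation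
          by (auto simp: cover_def)
        ultimately show ?thesis by simp
      next
        case horizontal
        then show ?thesis using mixed v p by blast
      qed
    next
      case h: horizontal
      from cyl cov(2) show ?thesis
      proof (cases rule: cover_cases)
        case vertical
        then show ?thesis using mixed h p by blast
      next
        case h': horizontal
        obtain q where q: "q \<in> open_edge (c (\<pi> x)) (c (\<pi> y))"
            "q \<in> open_edge (c (\<pi> x')) (c (\<pi> y'))" "g x = g x'"
          using on_horizontal[OF h p(1)] on_horizontal[OF h' p(2)]
          by (auto simp: add_coord_eq_iff[where d = d] carr)
        then have "\<pi> x = \<pi> x'" "\<pi> y = \<pi> y'"
          using c_edge[OF hor(1)[OF h] hor(1)[OF h']] by auto
        then show ?thesis using eq_iff[of x x'] eq_iff[of y y'] q(3) hor(2)[OF h] hor(2)[OF h'] by auto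
      qed
    qed
  qed
  then have "\<forall>x y x' y'. cover x y \<longrightarrow> cover x' y' \<longrightarrow> (x, y) \<noteq> (x', y') \<longrightarrow>
      open_edge (?e x) (?e y) \<inter> open_edge (?e x') (?e y') = {}"
    by blast
  ultimately show ?thesis unfolding hasse_embedding_def by blast
qed

lemma height_function_imp_cubic_realization_add_coord:
  assumes cyl: "cylindrical_projection \<pi>" and fin: "\<And>q. finite (\<pi> -` {q})"
    and base: "cubic_realization d c" and g: "height_function \<pi> g"
  shows "cubic_realization (d + 1) (\<lambda>x. add_coord (c (\<pi> x)) (g x))"
proof -
  have emb: "hasse_embedding d c" using base by (simp add: cubic_realization_def)
  have carr: "c q \<in> carrier_vec d" for q using emb by (auto simp: hasse_embedding_def)
  have "\<exists>i<d + 1. add_coord (c (\<pi> x)) (g x) $ i < add_coord (c (\<pi> y)) (g y) $ i \<and>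
      (\<forall>j<d + 1. j \<noteq> i \<longrightarrow> add_coord (c (\<pi> x)) (g x) $ j = add_coord (c (\<pi> y)) (g y) $ j)"
    if "cover x y" for x y
    using cyl that
  proof (cases rule: cover_cases)
    case vertical
    then have "\<pi> x = \<pi> y" "g x < g y" using g by (auto simp: height_function_def vertical_def)
    then show ?thesis
      by (intro exI[of _ d])
         (auto simp: add_coord_index_last[OF carr] add_coord_index_less[OF carr] less_Suc_eq)
  next
    case horizontal
    then have "cover (\<pi> x) (\<pi> y)" and eq: "g x = g y"
      using g by (auto simp: height_function_def horizontal_def)
    then obtain i where "i < d" "c (\<pi> x) $ i < c (\<pi> y) $ i"
        "\<forall>j<d. j \<noteq> i \<longrightarrow> c (\<pi> x) $ j = c (\<pi> y) $ j"
      using base unfolding cubic_realization_def by blast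
    then show ?thesis using eq
      by (intro exI[of _ i])
         (auto simp: add_coord_index_last[OF carr] add_coord_index_less[OF carr] less_Suc_eq)
  qed
  then show ?thesis
    using height_function_hasse_embedding[OF cyl fin emb g] unfolding cubic_realization_def
    by blast
qed

lemma height_functions_bij_compatible_realizations:
  assumes cyl: "cylindrical_projection \<pi>" and fin: "\<And>q. finite (\<pi> -` {q})"
    and base: "cubic_realization d c"
  shows "bij_betw (\<lambda>g x. add_coord (c (\<pi> x)) (g x)) {g. height_function \<pi> g}
           {c'. cubic_realization (d + 1) c' \<and> compatible c \<pi> c'}"
proof (rule bij_betw_imageI)
  have carr: "c q \<in> carrier_vec d" for q
    using base by (auto simp: cubic_realization_def hasse_embedding_def)
  show "inj_on (\<lambda>g x. add_coord (c (\<pi> x)) (g x)) {g. height_function \<pi> g}"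
    by (rule inj_onI) (auto simp: fun_eq_iff add_coord_eq_iff[OF carr carr])
  show "(\<lambda>g x. add_coord (c (\<pi> x)) (g x)) ` {g. height_function \<pi> g} =
      {c'. cubic_realization (d + 1) c' \<and> compatible c \<pi> c'}"
  proof (intro equalityI subsetI)
    fix c' assume "c' \<in> (\<lambda>g x. add_coord (c (\<pi> x)) (g x)) ` {g. height_function \<pi> g}"
    then show "c' \<in> {c'. cubic_realization (d + 1) c' \<and> compatible c \<pi> c'}"
      using height_function_imp_cubic_realization_add_coord[OF cyl fin base]
      by (auto simp: compatible_def)
  next
    fix c' assume c': "c' \<in> {c'. cubic_realization (d + 1) c' \<and> compatible c \<pi> c'}"
    then obtain g where "c' = (\<lambda>x. add_coord (c (\<pi> x)) (g x))"
      unfolding compatible_def by blast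
    then show "c' \<in> (\<lambda>g x. add_coord (c (\<pi> x)) (g x)) ` {g. height_function \<pi> g}"
      using c' cubic_realization_add_coord_imp_height_function[OF base] by blast
  qed
qed

section \<open>Acyclicity\<close>

lemma covers_locally_finite:
  fixes \<pi> :: "'p::order \<Rightarrow> 'q::order" and c :: "'q \<Rightarrow> real vec" and x :: 'p
  assumes cyl: "cylindrical_projection \<pi>" and fin: "\<And>q. finite (\<pi> -` {q})"
    and base: "cubic_realization d c"
  shows "finite {y. cover x y \<or> cover y x}"
proof (rule finite_subset)
  let ?N = "insert (\<pi> x) {q. cover (\<pi> x) q \<or> cover q (\<pi> x)}"
  show "{y. cover x y \<or> cover y x} \<subseteq> (\<Union>q\<in>?N. \<pi> -` {q})"
    using cyl unfolding cylindrical_projection_def by fastforce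
  show "finite (\<Union>q\<in>?N. \<pi> -` {q})"
    using fin cubic_realization_locally_finite[OF base] by auto
qed

text \<open>A vertex of the pre-Reeb graph is a connected component of the locally finite graph of
  horizontal covers, hence a countable set, and each of its elements has finitely many vertical
  covers.\<close>

lemma reeb_graph_locally_countable:
  fixes \<pi> :: "'p::order \<Rightarrow> 'q::order"
  assumes "\<And>x :: 'p. finite {y. cover x y \<or> cover y x}"
  shows "countable ((reeb_edges \<pi> \<union> (reeb_edges \<pi>)\<inverse>) `` {C})"
proof (cases "C \<in> reeb_verts \<pi>")
  case True
  then obtain v where C: "C = hclass \<pi> v"
    by (auto simp: reeb_verts_def hclass_def elim!: quotientE)
  have "(horizontal \<pi> \<union> (horizontal \<pi>)\<inverse>) `` {x} \<subseteq> {y. cover x y \<or> cover y x}" for x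
    by (auto simp: horizontal_def)
  then have "countable ((horizontal \<pi> \<union> (horizontal \<pi>)\<inverse>)\<^sup>* `` {v})"
    using assms by (intro countable_undirected_component) (meson countable_finite finite_subset)
  moreover have "C \<subseteq> (horizontal \<pi> \<union> (horizontal \<pi>)\<inverse>)\<^sup>* `` {v}"
  proof
    fix w assume "w \<in> C"
    then have "equivclp (\<lambda>x y. (x, y) \<in> horizontal \<pi>) v w"
      by (simp add: C hclass_def hequiv_def)
    then show "w \<in> (horizontal \<pi> \<union> (horizontal \<pi>)\<inverse>)\<^sup>* `` {v}"
      by induction (auto intro: rtrancl_into_rtrancl)
  qed
  ultimately have "countable C" by (meson countable_subset)
  then have "countable (hclass \<pi> ` (\<Union>x\<in>C. {y. cover x y \<or> cover y x}))"
    using assms by (intro countable_image countable_UN) (auto intro: countable_finite)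
  moreover have "(reeb_edges \<pi> \<union> (reeb_edges \<pi>)\<inverse>) `` {C} \<subseteq>
      hclass \<pi> ` (\<Union>x\<in>C. {y. cover x y \<or> cover y x})"
    unfolding reeb_edges_def vertical_def by (auto dest!: reeb_vert_eq_hclass)
  ultimately show ?thesis by (rule countable_subset[rotated])
next
  case False
  then have "(reeb_edges \<pi> \<union> (reeb_edges \<pi>)\<inverse>) `` {C} = {}" by (auto simp: reeb_edges_def)
  then show ?thesis by simp
qed

lemma reeb_heights_nonempty_iff_acyclic:
  fixes \<pi> :: "'p::order \<Rightarrow> 'q::order"
  assumes "\<And>x :: 'p. finite {y. cover x y \<or> cover y x}"
  shows "reeb_heights \<pi> \<noteq> {} \<longleftrightarrow> acyclic (reeb_edges \<pi>)"
proof
  assume "reeb_heights \<pi> \<noteq> {}"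
  then obtain h where "h \<in> reeb_heights \<pi>" by blast
  then show "acyclic (reeb_edges \<pi>)"
    by (intro acyclic_if_strictly_increasing[of _ h]) (auto simp: reeb_heights_def)
next
  assume "acyclic (reeb_edges \<pi>)"
  then obtain h :: "'p set \<Rightarrow> real" where "\<And>C D. (C, D) \<in> reeb_edges \<pi> \<Longrightarrow> h C < h D"
    using acyclic_locally_countable_strictly_increasing[OF _ reeb_graph_locally_countable[OF assms]]
    by metis
  then have "restrict h (reeb_verts \<pi>) \<in> reeb_heights \<pi>"
    by (auto simp: reeb_heights_def reeb_edges_def)
  then show "reeb_heights \<pi> \<noteq> {}" by blast
qed

section \<open>The correspondence\<close>

theorem proposition1p9:
  fixes \<pi> :: "'p::order \<Rightarrow> 'q::order"
    and c\<^sub>Q :: "'q \<Rightarrow> real vec"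
    and d :: nat
  assumes "cylindrical_projection \<pi>"
    and "\<And>q. finite (\<pi> -` {q})"
    and "cubic_realization d c\<^sub>Q"
  shows "bij_betw (\<lambda>h x. add_coord (c\<^sub>Q (\<pi> x)) (h (hclass \<pi> x)))
           (reeb_heights \<pi>)
           {c\<^sub>P. cubic_realization (d + 1) c\<^sub>P \<and> compatible c\<^sub>Q \<pi> c\<^sub>P}
         \<and> ((\<exists>c\<^sub>P. cubic_realization (d + 1) c\<^sub>P \<and> compatible c\<^sub>Q \<pi> c\<^sub>P) \<longleftrightarrow> acyclic (reeb_edges \<pi>))"
proof
  let ?R = "{c\<^sub>P. cubic_realization (d + 1) c\<^sub>P \<and> compatible c\<^sub>Q \<pi> c\<^sub>P}"
  show bij: "bij_betw (\<lambda>h x. add_coord (c\<^sub>Q (\<pi> x)) (h (hclass \<pi> x))) (reeb_heights \<pi>) ?R"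
    using bij_betw_trans[OF reeb_heights_bij_height_functions
        height_functions_bij_compatible_realizations[OF assms]]
    by (simp add: comp_def)
  have "(\<exists>c\<^sub>P. cubic_realization (d + 1) c\<^sub>P \<and> compatible c\<^sub>Q \<pi> c\<^sub>P) \<longleftrightarrow> ?R \<noteq> {}" by blast
  also have "\<dots> \<longleftrightarrow> reeb_heights \<pi> \<noteq> {}" using bij_betw_imp_surj_on[OF bij] by auto
  also have "\<dots> \<longleftrightarrow> acyclic (reeb_edges \<pi>)"
    by (rule reeb_heights_nonempty_iff_acyclic) (rule covers_locally_finite[OF assms])
  finally show "(\<exists>c\<^sub>P. cubic_realization (d + 1) c\<^sub>P \<and> compatible c\<^sub>Q \<pi> c\<^sub>P) \<longleftrightarrow>
    acyclic (reeb_edges \<pi>)" .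
qed

end
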